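(* Let $\mathcal{A}$ be any algorithm, bounded in computation or unbounded, that recovers the base sequence $B$ from $T$ known-plaintext pairs. Even given $B$ as additional input, any algorithm attempting to determine a future message $M$ from its ciphertext $C$, where $C$ is produced by the MR-OTP with base sequence $B$ under a fresh key independent of all observed pairs, succeeds with probability at most $\Pr[M=m]$ for any $m$. For every message distribution $\Pr[M]$, every base sequence $B$, and every ciphertext $c$ with $\Pr[C=c]>0$ under a fresh key, $$\Pr[M=m\mid C=c,\,B=b]=\Pr[M=m]\qquad\text{for all } m.$$
   Context: A base sequence is a tuple $B=(b_1,\dots,b_L)$ of integers $b_i\in\{2,\dots,b_{\max}\}$; its key space is $\mathcal{K}_B=\prod_{i=1}^L\{0,\dots,b_i-1\}$. In the displayed equation $b$ denotes the value of the base sequence $B$. MR-OTP (Mixed-Radix One-Time Pad) with base sequence $B$: a message $m=(m_1,\dots,m_L)$ with $0\le m_i<b_i$ is encrypted under a key $K=(k_1,\dots,k_L)\in\mathcal{K}_B$ as the ciphertext $c=(c_1,\dots,c_L)$ with $c_i=(m_i+k_i)\bmod b_i$. A fresh key is a key drawn uniformly from $\mathcal{K}_B$ for that encryption. Known-plaintext pairs: $T\ge 1$ pairs $(M^{(1)},C^{(1)}),\dots,(M^{(T)},C^{(T)})$, where each $C^{(t)}$ is the MR-OTP encryption of $M^{(t)}$ under a fresh key $K^{(t)}$ drawn uniformly from $\mathcal{K}_B$, the base sequence $B$ (drawn uniformly at random from $\{2,\dots,b_{\max}\}^L$ in the recovery problem) being the same for all $T$ pairs.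
   Formalization: The success bound, false if read for every m, is stated as: an answer m is right with probability at most Pr[M=m] given that m is answered, and total success is at most max_m Pr[M=m]; the future message itself, not only its key, is independent of the observed pairs given B. *)

theory Defs
  imports "HOL-Probability.Probability"
begin

definition base_seqs :: "nat \<Rightarrow> nat \<Rightarrow> nat list set" where
  "base_seqs L bmax = {B. length B = L \<and> set B \<subseteq> {2..bmax}}"

definition key_space :: "nat list \<Rightarrow> nat list set" where
  "key_space B = {K. length K = length B \<and> (\<forall>i<length B. K ! i < B ! i)}"

abbreviation message_space :: "nat list \<Rightarrow> nat list set" where
  "message_space \<equiv> key_space"

definition mrotp_enc :: "nat list \<Rightarrow> nat list \<Rightarrow> nat list \<Rightarrow> nat list" where
  "mrotp_enc B K M = map (\<lambda>i. (M ! i + K ! i) mod (B ! i)) [0..<length B]"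

definition fresh_key :: "nat list \<Rightarrow> nat list pmf" where
  "fresh_key B = pmf_of_set (key_space B)"

text \<open>The known plaintexts may have an arbitrary joint distribution \<open>Q\<close>, in particular they need
  not be independent of each other; the keys are independent and uniform.\<close>

definition known_pairs ::
    "nat list \<Rightarrow> nat \<Rightarrow> nat list list pmf \<Rightarrow> (nat list \<times> nat list) list pmf" where
  "known_pairs B T Q = do {
     Ms \<leftarrow> Q;
     Ks \<leftarrow> replicate_pmf T (fresh_key B);
     return_pmf (zip Ms (map2 (mrotp_enc B) Ks Ms)) }"

text \<open>The random experiment. The distributions \<open>Q B\<close> of the known plaintexts and \<open>P B\<close> of the
  future message take the base sequence as a parameter because the message space depends on it.
  Algorithms are arbitrary randomized maps, with no computational restriction: \<open>A\<close> maps the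
  observed pairs to a candidate base sequence, and \<open>D\<close> maps the observed pairs, the output of
  \<open>A\<close>, the true base sequence and the new ciphertext to a candidate for the new message. The
  outcome consists of the base sequence, the future message, its ciphertext and the answer of
  \<open>D\<close>.\<close>

definition mrotp_experiment ::
    "nat \<Rightarrow> nat \<Rightarrow> nat \<Rightarrow> (nat list \<Rightarrow> nat list list pmf) \<Rightarrow> (nat list \<Rightarrow> nat list pmf) \<Rightarrow>
     ((nat list \<times> nat list) list \<Rightarrow> nat list pmf) \<Rightarrow>
     ((nat list \<times> nat list) list \<Rightarrow> nat list \<Rightarrow> nat list \<Rightarrow> nat list \<Rightarrow> nat list pmf) \<Rightarrow>
     (nat list \<times> nat list \<times> nat list \<times> nat list) pmf" where
  "mrotp_experiment L bmax T Q P A D = do {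
     B \<leftarrow> pmf_of_set (base_seqs L bmax);
     obs \<leftarrow> known_pairs B T (Q B);
     Bguess \<leftarrow> A obs;
     M \<leftarrow> P B;
     K \<leftarrow> fresh_key B;
     let C = mrotp_enc B K M;
     ans \<leftarrow> D obs Bguess B C;
     return_pmf (B, M, C, ans) }"

end

theory Submission
  imports Defs
begin

text \<open>For a fixed message, encryption under a uniform key is a bijective image of the key, so the
  ciphertext is uniform whatever the message. Given the base sequence, the new ciphertext and the
  answer are therefore jointly independent of the message, and conditioning on either of them leaves
  the distribution of the message unchanged. A guess independent of the message is right with
  probability at most that of the likeliest message.\<close>

lemma finite_key_space: "finite (key_space B)"
proof (rule finite_subset)
  \<comment> \<open>Each digit lies below its base, hence below \<open>sum_list B\<close>, which
    serves as a crude common bound.\<close>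
  show "key_space B \<subseteq> {K. set K \<subseteq> {..sum_list B} \<and> length K = length B}"
    by (force simp: key_space_def in_set_conv_nth
        intro: order.trans[OF less_imp_le elem_le_sum_list])
  show "finite {K. set K \<subseteq> {..sum_list B} \<and> length K = length B}"
    by (rule finite_lists_length_eq) simp
qed

lemma key_space_nonempty: "(\<And>x. x \<in> set B \<Longrightarrow> 0 < x) \<Longrightarrow> key_space B \<noteq> {}"
  by (auto simp: key_space_def intro!: exI[of _ "replicate (length B) 0"])

lemma base_seqs_pos: "B \<in> base_seqs L bmax \<Longrightarrow> x \<in> set B \<Longrightarrow> 0 < x"
  by (auto simp: base_seqs_def)

lemma finite_base_seqs: "finite (base_seqs L bmax)"
  unfolding base_seqs_def using finite_lists_length_eq[of "{2..bmax}" L]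
  by (simp add: conj_commute)

text \<open>By symmetry \<open>x \<le> y\<close>, so truncated subtraction is exact; then
  \<open>n\<close> divides \<open>y - x\<close>, which is less than \<open>n\<close> and so
  zero.\<close>

lemma add_mod_left_cancel_nat:
  fixes m x y n :: nat
  assumes "(m + x) mod n = (m + y) mod n" "x < n" "y < n"
  shows "x = y"
  using assms
proof (induction x y rule: linorder_wlog)
  case (le x y)
  then have "n dvd (m + y) - (m + x)"
    by (metis add_le_cancel_left mod_eq_dvd_iff_nat)
  then have "n dvd y - x"
    by simp
  with le show ?case
    using nat_dvd_not_less[of "y - x" n] by linarith
qed simp

lemma inj_on_mrotp_enc: "inj_on (\<lambda>K. mrotp_enc B K M) (key_space B)"
proof (rule inj_onI)
  fix K K'
  assume K: "K \<in> key_space B" "K' \<in> key_space B" and eq: "mrotp_enc B K M = mrotp_enc B K' M"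
  have "K ! i = K' ! i" if "i < length B" for i
  proof (rule add_mod_left_cancel_nat)
    show "(M ! i + K ! i) mod (B ! i) = (M ! i + K' ! i) mod (B ! i)"
      using arg_cong[OF eq, of "\<lambda>C. C ! i"] that by (simp add: mrotp_enc_def)
  qed (use K that in \<open>auto simp: key_space_def\<close>)
  then show "K = K'"
    using K by (auto simp: key_space_def intro: nth_equalityI)
qed

text \<open>An injective self-map of a finite set is a permutation and preserves the uniform
  distribution. Positive bases keep the residues inside the key space and make that space
  nonempty.\<close>

lemma map_mrotp_enc_fresh_key:
  assumes "\<And>x. x \<in> set B \<Longrightarrow> 0 < x"
  shows "map_pmf (\<lambda>K. mrotp_enc B K M) (fresh_key B) = fresh_key B"
proof -
  have "(\<lambda>K. mrotp_enc B K M) ` key_space B \<subseteq> key_space B"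
    using assms by (auto simp: mrotp_enc_def key_space_def)
  then have "(\<lambda>K. mrotp_enc B K M) ` key_space B = key_space B"
    by (intro endo_inj_surj finite_key_space inj_on_mrotp_enc)
  then show ?thesis
    unfolding fresh_key_def
    using map_pmf_of_set_inj[OF inj_on_mrotp_enc key_space_nonempty[OF assms] finite_key_space]
    by simp
qed

text \<open>The ciphertext and the answer, with the encryption of the message replaced by a uniform
  element of the key space.\<close>

definition simulated_view ::
    "(nat list \<times> nat list) list pmf \<Rightarrow> ((nat list \<times> nat list) list \<Rightarrow> nat list pmf) \<Rightarrow>
     ((nat list \<times> nat list) list \<Rightarrow> nat list \<Rightarrow> nat list \<Rightarrow> nat list \<Rightarrow> nat list pmf) \<Rightarrow>
     nat list \<Rightarrow> (nat list \<times> nat list) pmf" where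
  "simulated_view Obs A D B = do {
     obs \<leftarrow> Obs;
     Bguess \<leftarrow> A obs;
     C \<leftarrow> fresh_key B;
     ans \<leftarrow> D obs Bguess B C;
     return_pmf (C, ans) }"

text \<open>Once the ciphertext is drawn without reference to the message, the message enters only
  the recorded outcome. For each \<open>B\<close>, the experiment therefore becomes a product
  distribution.\<close>

lemma mrotp_experiment_eq:
  assumes "base_seqs L bmax \<noteq> {}"
  shows "mrotp_experiment L bmax T Q P A D =
     bind_pmf (pmf_of_set (base_seqs L bmax)) (\<lambda>B.
       map_pmf (Pair B) (pair_pmf (P B) (simulated_view (known_pairs B T (Q B)) A D B)))"
  unfolding mrotp_experiment_def
proof (rule bind_pmf_cong[OF refl])
  fix B
  assume "B \<in> set_pmf (pmf_of_set (base_seqs L bmax))"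
  then have "B \<in> base_seqs L bmax"
    by (simp add: set_pmf_of_set[OF assms finite_base_seqs])
  note uniform = map_mrotp_enc_fresh_key[OF base_seqs_pos[OF this]]
  \<comment> \<open>\<open>F\<close> stands for the rest of the experiment, which sees the key only
    through the ciphertext. It may depend on \<open>M\<close>, which is fixed at this point.\<close>
  have enc: "bind_pmf (fresh_key B) (\<lambda>K. F (mrotp_enc B K M)) = bind_pmf (fresh_key B) F"
    for M and F :: "nat list \<Rightarrow> (nat list \<times> nat list \<times> nat list \<times> nat list) pmf"
    using bind_map_pmf[of "\<lambda>K. mrotp_enc B K M" "fresh_key B" F] by (simp add: uniform)
  have "do {
     obs \<leftarrow> known_pairs B T (Q B);
     Bguess \<leftarrow> A obs;
     M \<leftarrow> P B;
     K \<leftarrow> fresh_key B;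
     let C = mrotp_enc B K M;
     ans \<leftarrow> D obs Bguess B C;
     return_pmf (B, M, C, ans) } =
   do {
     obs \<leftarrow> known_pairs B T (Q B);
     Bguess \<leftarrow> A obs;
     M \<leftarrow> P B;
     C \<leftarrow> fresh_key B;
     ans \<leftarrow> D obs Bguess B C;
     return_pmf (B, M, C, ans) }"
    unfolding Let_def by (intro bind_pmf_cong refl enc)
  \<comment> \<open>Instantiated at \<open>P B\<close>, commutation pushes the draw of the message
    inward past the other draws on both sides.\<close>
  also have "\<dots> = map_pmf (Pair B) (pair_pmf (P B) (simulated_view (known_pairs B T (Q B)) A D B))"
    by (simp add: pair_pmf_def simulated_view_def map_pmf_def bind_assoc_pmf bind_return_pmf
        bind_commute_pmf[of "P B"])
  finally show "do {
     obs \<leftarrow> known_pairs B T (Q B);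
     Bguess \<leftarrow> A obs;
     M \<leftarrow> P B;
     K \<leftarrow> fresh_key B;
     let C = mrotp_enc B K M;
     ans \<leftarrow> D obs Bguess B C;
     return_pmf (B, M, C, ans) } =
   map_pmf (Pair B) (pair_pmf (P B) (simulated_view (known_pairs B T (Q B)) A D B))" .
qed

text \<open>The law of total probability over the reals. It is obtained from the
  \<open>ennreal\<close> version, the bound 1 on probabilities giving integrability.\<close>

lemma measure_bind_pmf_integral:
  "measure_pmf.prob (bind_pmf N F) X = (\<integral>x. measure_pmf.prob (F x) X \<partial>measure_pmf N)"
proof -
  have "ennreal (measure_pmf.prob (bind_pmf N F) X)
      = (\<integral>\<^sup>+x. ennreal (measure_pmf.prob (F x) X) \<partial>measure_pmf N)"
    by (simp flip: measure_pmf.emeasure_eq_measure)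
  also have "\<dots> = ennreal (\<integral>x. measure_pmf.prob (F x) X \<partial>measure_pmf N)"
    by (intro nn_integral_eq_integral measure_pmf.integrable_const_bound[where B = 1]) auto
  finally show ?thesis
    by (simp add: integral_nonneg_AE)
qed

text \<open>The first component records \<open>x\<close>, so only the branch \<open>x = b\<close>
  contributes. This isolates one base sequence; with a constant family \<open>V\<close> it also
  covers independent pairs.\<close>

lemma prob_bind_map_Pair:
  "measure_pmf.prob (bind_pmf N (\<lambda>x. map_pmf (Pair x) (V x))) {(x, y). R y \<and> x = b}
     = pmf N b * measure_pmf.prob (V b) {y. R y}"
proof -
  have "measure_pmf.prob (bind_pmf N (\<lambda>x. map_pmf (Pair x) (V x))) {(x, y). R y \<and> x = b}
     = (\<integral>x. measure_pmf.prob (V x) {y. R y \<and> x = b} \<partial>measure_pmf N)"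
    by (simp add: measure_bind_pmf_integral vimage_def)
  also have "\<dots> = (\<integral>x. indicator {b} x * measure_pmf.prob (V b) {y. R y} \<partial>measure_pmf N)"
    by (intro Bochner_Integration.integral_cong) (auto simp: indicator_def)
  finally show ?thesis
    by (simp add: measure_pmf_single)
qed

lemma prob_pair_pmf_fst_eq:
  "measure_pmf.prob (pair_pmf p q) {(x, y). x = m \<and> S y} = pmf p m * measure_pmf.prob q {y. S y}"
proof -
  have "pair_pmf p q = bind_pmf p (\<lambda>x. map_pmf (Pair x) q)"
    by (simp add: pair_pmf_def map_pmf_def)
  then show ?thesis
    using prob_bind_map_Pair[of p "\<lambda>_. q" S m] by (simp add: conj_commute)
qed

text \<open>With \<open>y\<close> drawn first, the guess \<open>g y\<close> is fixed and hits with
  probability \<open>pmf p (g y)\<close>; averaging over \<open>y\<close> preserves the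
  bound.\<close>

lemma prob_pair_pmf_guess_le:
  assumes "\<And>x. pmf p x \<le> c"
  shows "measure_pmf.prob (pair_pmf p q) {(x, y). g y = x} \<le> c"
proof -
  have "pair_pmf p q = bind_pmf q (\<lambda>y. map_pmf (\<lambda>x. (x, y)) p)"
    by (subst pair_commute_pmf) (simp add: pair_pmf_def map_pmf_def bind_assoc_pmf bind_return_pmf)
  then have "measure_pmf.prob (pair_pmf p q) {(x, y). g y = x} = (\<integral>y. pmf p (g y) \<partial>measure_pmf q)"
    by (simp add: measure_bind_pmf_integral vimage_def measure_pmf_single)
  also have "\<dots> \<le> c"
    by (intro measure_pmf.integral_le_const measure_pmf.integrable_const_bound[where B = 1])
      (auto simp: assms pmf_le_1)
  finally show ?thesis .
qed

theorem theorem8p15: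
  fixes L bmax T :: nat
    and Q :: "nat list \<Rightarrow> nat list list pmf"
    and P :: "nat list \<Rightarrow> nat list pmf"
    and A :: "(nat list \<times> nat list) list \<Rightarrow> nat list pmf"
    and D :: "(nat list \<times> nat list) list \<Rightarrow> nat list \<Rightarrow> nat list \<Rightarrow> nat list \<Rightarrow> nat list pmf"
    and b :: "nat list"
  assumes "bmax \<ge> 2" and "T \<ge> 1"
    and "\<And>B. B \<in> base_seqs L bmax \<Longrightarrow>
           set_pmf (Q B) \<subseteq> {Ms. length Ms = T \<and> set Ms \<subseteq> message_space B}"
    and "\<And>B. B \<in> base_seqs L bmax \<Longrightarrow> set_pmf (P B) \<subseteq> message_space B"
    and "b \<in> base_seqs L bmax"
  defines "E \<equiv> measure_pmf (mrotp_experiment L bmax T Q P A D)"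
  shows "(\<forall>m. \<P>((B, M, C, ans) in E. ans = m \<and> B = b) > 0 \<longrightarrow>
             \<P>((B, M, C, ans) in E. ans = M \<bar> ans = m \<and> B = b) \<le> pmf (P b) m) \<and>
         \<P>((B, M, C, ans) in E. ans = M \<bar> B = b) \<le> (MAX m\<in>message_space b. pmf (P b) m) \<and>
         (\<forall>c. \<P>((B, M, C, ans) in E. C = c \<and> B = b) > 0 \<longrightarrow>
             (\<forall>m. \<P>((B, M, C, ans) in E. M = m \<bar> C = c \<and> B = b) = pmf (P b) m))"
proof -
  define V where "V = simulated_view (known_pairs b T (Q b)) A D b"
  \<comment> \<open>The probability of \<open>B = b\<close>: a positive factor of every joint
    probability below, cancelling in each conditional one.\<close>
  define w where "w = pmf (pmf_of_set (base_seqs L bmax)) b"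
  have ne: "base_seqs L bmax \<noteq> {}"
    using assms(5) by auto
  have w: "w > 0"
    unfolding w_def using assms(5) ne finite_base_seqs[of L bmax] by (simp add: card_gt_0_iff)
  have E: "\<P>((B, M, C, ans) in E. R M C ans \<and> B = b)
      = w * measure_pmf.prob (pair_pmf (P b) V) {(M, C, ans). R M C ans}" for R
    using prob_bind_map_Pair[of _ _ "\<lambda>(M, C, ans). R M C ans" b]
    by (simp add: E_def mrotp_experiment_eq[OF ne] V_def w_def case_prod_unfold)
  have joint: "\<P>((B, M, C, ans) in E. (M = m \<and> S C ans) \<and> B = b)
      = w * (pmf (P b) m * measure_pmf.prob V {(C, ans). S C ans})" for m S
    using prob_pair_pmf_fst_eq[of "P b" V m "\<lambda>(C, ans). S C ans"]
      E[of "\<lambda>M C ans. M = m \<and> S C ans"]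
    by (simp add: case_prod_unfold)
  have view: "\<P>((B, M, C, ans) in E. S C ans \<and> B = b)
      = w * measure_pmf.prob V {(C, ans). S C ans}" for S
  proof -
    have "measure_pmf.prob (map_pmf snd (pair_pmf (P b) V)) {(C, ans). S C ans}
        = measure_pmf.prob V {(C, ans). S C ans}"
      by (simp only: map_snd_pair_pmf)
    then show ?thesis
      using E[of "\<lambda>M C ans. S C ans"] by (simp add: vimage_def case_prod_unfold)
  qed
  \<comment> \<open>Numerator and denominator share the factor \<open>w\<close> times the
    probability of \<open>S\<close> under \<open>V\<close>, which is nonzero by the positivity
    assumption.\<close>
  have cond: "\<P>((B, M, C, ans) in E. M = m \<bar> S C ans \<and> B = b) = pmf (P b) m"
    if "\<P>((B, M, C, ans) in E. S C ans \<and> B = b) > 0" for m S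
    using that joint[of m S] view[of S] w
    by (auto simp: cond_prob_def case_prod_unfold conj_assoc)
  have answer: "\<P>((B, M, C, ans) in E. ans = M \<bar> ans = m \<and> B = b) \<le> pmf (P b) m"
    if "\<P>((B, M, C, ans) in E. ans = m \<and> B = b) > 0" for m
  proof -
    \<comment> \<open>Under the condition \<open>ans = m\<close>, the events \<open>ans = M\<close>
      and \<open>M = m\<close> coincide.\<close>
    have "\<P>((B, M, C, ans) in E. ans = M \<bar> ans = m \<and> B = b)
        = \<P>((B, M, C, ans) in E. M = m \<bar> ans = m \<and> B = b)"
      by (auto simp: cond_prob_def case_prod_unfold intro!: arg_cong2[where f = "(/)"]
          arg_cong[where f = "measure E"])
    also have "\<dots> = pmf (P b) m"
      using cond[of "\<lambda>_ ans. ans = m"] that by simp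
    finally show ?thesis by simp
  qed
  \<comment> \<open>The bound has to cover all lists, as \<open>D\<close> may answer outside
    \<open>message_space b\<close>. There the probability is zero, while the maximum is nonnegative
    because the space is nonempty.\<close>
  have max: "pmf (P b) m \<le> (MAX m\<in>message_space b. pmf (P b) m)" for m
  proof (cases "m \<in> message_space b")
    case True
    then show ?thesis by (simp add: finite_key_space)
  next
    case False
    then have "pmf (P b) m = 0"
      using assms(4)[OF assms(5)] by (auto simp: pmf_eq_0_set_pmf)
    moreover obtain m' where "m' \<in> message_space b"
      using key_space_nonempty[of b] base_seqs_pos[OF assms(5)] by blast
    then have "pmf (P b) m' \<le> (MAX m\<in>message_space b. pmf (P b) m)"
      by (simp add: finite_key_space)
    ultimately show ?thesis
      using pmf_nonneg[of "P b" m'] by linarith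
  qed
  have "\<P>((B, M, C, ans) in E. ans = M \<bar> B = b)
      = measure_pmf.prob (pair_pmf (P b) V) {(M, C, ans). ans = M}"
    \<comment> \<open>The trivial event yields the denominator \<open>w\<close>.\<close>
    using E[of "\<lambda>M C ans. ans = M"] E[of "\<lambda>M C ans. True"] w
    by (simp add: cond_prob_def case_prod_unfold)
  also have "\<dots> \<le> (MAX m\<in>message_space b. pmf (P b) m)"
    using prob_pair_pmf_guess_le[of "P b", OF max, of V snd] by (simp add: case_prod_unfold)
  finally have guess: "\<P>((B, M, C, ans) in E. ans = M \<bar> B = b)
      \<le> (MAX m\<in>message_space b. pmf (P b) m)" .
  show ?thesis
    using answer guess cond[of "\<lambda>C _. C = c" for c] by blast
qed

end
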